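(* Let $G$ be a finite group, let $\mathrm{A}$ be a graph with vertex set $G$, and let $\mathrm{B}$ be a partition of $G$ (equivalently, an equivalence relation on $G$), with equivalence classes of sizes $n_1,\dots,n_r$. Then the $\mathrm{B}$ super$\mathrm{A}$ graph on $G$ is isomorphic to a generalized composition $\Delta[K_{n_1},\dots,K_{n_r}]$ for some graph $\Delta$ on $r$ vertices.
   Context: All graphs are simple and undirected. $K_n$ is the complete graph on $n$ vertices. Given a graph $\mathrm{A}$ with vertex set $G$ and a partition $\mathrm{B}$ of $G$, with $[g]_{\mathrm{B}}$ denoting the class of $g$, the $\mathrm{B}$ super$\mathrm{A}$ graph has vertex set $G$; distinct $g,h$ are adjacent if and only if either $[g]_{\mathrm{B}}=[h]_{\mathrm{B}}$, or there exist $g'\in[g]_{\mathrm{B}}$ and $h'\in[h]_{\mathrm{B}}$ such that $g'$ is adjacent to $h'$ in $\mathrm{A}$. Generalized composition: if $\mathcal{H}$ is a graph with vertex set $\{1,\dots,k\}$ and $\Gamma_1,\dots,\Gamma_k$ are graphs, then $\mathcal{H}[\Gamma_1,\dots,\Gamma_k]$ is the graph with vertex set $V(\Gamma_1)\sqcup\cdots\sqcup V(\Gamma_k)$ in which $u\in V(\Gamma_i)$ and $v\in V(\Gamma_j)$ are adjacent if and only if either $i=j$ and $u,v$ are adjacent in $\Gamma_i$, or $i\ne j$ and $i,j$ are adjacent in $\mathcal{H}$. *)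

theory Defs
  imports "HOL-Algebra.Group" "HOL-Library.Disjoint_Sets" "Graph_Theory.Graph_Theory"
begin

text \<open>
  A finite simple undirected graph is a \<^typ>\<open>'a pair_pre_digraph\<close> satisfying the locale predicate
  \<^const>\<open>pair_graph\<close>; an edge between \<open>u\<close> and \<open>v\<close> is represented by the two arcs \<open>(u, v)\<close> and \<open>(v, u)\<close>.
\<close>

text \<open>Meaningful only if \<open>g\<close> lies in exactly one member of \<open>B\<close>, e.g. if \<open>B\<close> partitions a set containing \<open>g\<close>.\<close>
definition block_of :: "'a set set \<Rightarrow> 'a \<Rightarrow> 'a set" where
  "block_of B g = (THE X. X \<in> B \<and> g \<in> X)"

definition super_graph :: "'a set set \<Rightarrow> 'a pair_pre_digraph \<Rightarrow> 'a pair_pre_digraph" where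
  "super_graph B A =
    \<lparr> pverts = pverts A,
      parcs = {(g, h). g \<in> pverts A \<and> h \<in> pverts A \<and> g \<noteq> h \<and>
        (block_of B g = block_of B h \<or>
         (\<exists>g' \<in> block_of B g. \<exists>h' \<in> block_of B h. (g', h') \<in> parcs A))} \<rparr>"

definition complete_graph :: "nat \<Rightarrow> nat pair_pre_digraph" where
  "complete_graph n =
    \<lparr> pverts = {1..n}, parcs = {(u, v). u \<in> {1..n} \<and> v \<in> {1..n} \<and> u \<noteq> v} \<rparr>"

text \<open>The vertex \<open>u\<close> of the summand \<open>\<Gamma> i\<close> of the disjoint union is the pair \<open>(i, u)\<close>.\<close>
definition generalized_composition ::
    "'i pair_pre_digraph \<Rightarrow> ('i \<Rightarrow> 'v pair_pre_digraph) \<Rightarrow> ('i \<times> 'v) pair_pre_digraph" where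
  "generalized_composition H \<Gamma> =
    \<lparr> pverts = (SIGMA i : pverts H. pverts (\<Gamma> i)),
      parcs = {((i, u), (j, v)). i \<in> pverts H \<and> u \<in> pverts (\<Gamma> i) \<and> j \<in> pverts H \<and> v \<in> pverts (\<Gamma> j) \<and>
        (i = j \<and> (u, v) \<in> parcs (\<Gamma> i) \<or> i \<noteq> j \<and> (i, j) \<in> parcs H)} \<rparr>"

lemma block_of_eq:
  assumes "partition_on S B" "X \<in> B" "g \<in> X"
  shows "block_of B g = X"
  unfolding block_of_def
  using assms by (intro the_equality) (auto simp: partition_on_def disjoint_def)

lemma complete_graph: "K\<^bsub>n\<^esub> (with_proj (complete_graph n))"
  by (auto simp: complete_digraph_pair_def complete_graph_def)

lemma pair_graph_super_graph:
  assumes "pair_graph A"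
  shows "pair_graph (super_graph B A)"
proof -
  interpret A: pair_graph A by fact
  have "parcs (super_graph B A) \<subseteq> pverts A \<times> pverts A"
    by (auto simp: super_graph_def)
  then have "finite (parcs (super_graph B A))"
    using A.pair_finite_verts finite_subset by blast
  moreover have "sym (parcs (super_graph B A))"
    unfolding super_graph_def by (rule symI) (simp, metis A.arcs_symmetric)
  ultimately show ?thesis
    by unfold_locales (auto simp: super_graph_def symmetric_def A.pair_finite_verts)
qed

lemma pair_graph_generalized_composition:
  assumes "pair_graph H" "\<And>i. i \<in> pverts H \<Longrightarrow> pair_graph (\<Gamma> i)"
  shows "pair_graph (generalized_composition H \<Gamma>)"
proof -
  let ?C = "generalized_composition H \<Gamma>"
  interpret H: pair_graph H by fact
  have fin: "finite (pverts ?C)"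
    unfolding generalized_composition_def
    by (simp add: H.pair_finite_verts assms(2) pair_fin_digraph.pair_finite_verts
        pair_digraph.axioms(1) pair_graph.axioms(1))
  have sub: "parcs ?C \<subseteq> pverts ?C \<times> pverts ?C"
    by (auto simp: generalized_composition_def)
  have \<Gamma>: "(v, u) \<in> parcs (\<Gamma> i) \<and> u \<noteq> v" if "i \<in> pverts H" "(u, v) \<in> parcs (\<Gamma> i)" for i u v
  proof -
    interpret \<Gamma>: pair_graph "\<Gamma> i" using assms(2) that(1) .
    show ?thesis
      using that(2) \<Gamma>.arcs_symmetric \<Gamma>.no_loops' by blast
  qed
  have "sym (parcs ?C)"
  proof (rule symI)
    fix x y assume "(x, y) \<in> parcs ?C"
    then show "(y, x) \<in> parcs ?C"
      using \<Gamma>[of "fst x" "snd x" "snd y"] H.arcs_symmetric[of "fst x" "fst y"]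
      by (cases x; cases y; cases "fst x = fst y") (simp_all add: generalized_composition_def)
  qed
  moreover have "\<forall>e \<in> parcs ?C. fst e \<noteq> snd e"
    unfolding generalized_composition_def by clarsimp (use \<Gamma> in blast)
  ultimately show ?thesis
    using fin sub finite_subset[OF sub]
    by unfold_locales (auto simp: symmetric_def)
qed

end

theory Submission
  imports Defs
begin

text \<open>
  Whether two distinct vertices in different blocks are adjacent in the super graph depends only on
  the blocks, and the vertices of one block form a clique. So take for \<open>\<Delta>\<close> the quotient graph on the
  blocks, and identify the block \<open>C i\<close> with \<open>{1..n i}\<close> by an arbitrary bijection.
\<close>

text \<open>An arc of a pair digraph is just the pair of its end points, so a vertex bijection that
  preserves and reflects arcs already determines the arc map, namely \<open>map_prod f f\<close>.
  This reduces \<open>digraph_iso\<close> to a condition on vertices.\<close>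

lemma digraph_iso_with_projI:
  assumes "pair_wf_digraph G" and "pair_wf_digraph H"
    and f: "bij_betw f (pverts G) (pverts H)"
    and arcs: "\<And>u v. u \<in> pverts G \<Longrightarrow> v \<in> pverts G \<Longrightarrow> (f u, f v) \<in> parcs H \<longleftrightarrow> (u, v) \<in> parcs G"
  shows "digraph_iso (with_proj G) (with_proj H)"
proof -
  interpret G: pair_wf_digraph G by fact
  interpret H: pair_wf_digraph H by fact
  \<comment> \<open>In \<open>with_proj H\<close> tail and head are the projections, so the image
    graph must receive \<open>fst\<close> and \<open>snd\<close> to be equal to it and not merely
    similar.\<close>
  let ?h = "\<lparr> iso_verts = f, iso_arcs = map_prod f f, iso_head = snd, iso_tail = fst \<rparr>"
  have sub: "parcs G \<subseteq> pverts G \<times> pverts G"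
    using G.in_arcsD1 G.in_arcsD2 by auto
  have inj: "inj_on f (pverts G)" and img: "f ` pverts G = pverts H"
    using f by (auto simp: bij_betw_def)
  have "inj_on (map_prod f f) (parcs G)"
    using map_prod_inj_on[OF inj inj] sub by (rule inj_on_subset)
  then have "G.digraph_isomorphism ?h"
    using inj G.wf_digraph by (auto simp: G.digraph_isomorphism_def)
  moreover have "map_prod f f ` parcs G = parcs H"
  proof
    show "map_prod f f ` parcs G \<subseteq> parcs H"
      using arcs sub by auto
    show "parcs H \<subseteq> map_prod f f ` parcs G"
    proof clarify
      fix x y assume xy: "(x, y) \<in> parcs H"
      then have "x \<in> f ` pverts G" "y \<in> f ` pverts G"
        using img H.in_arcsD1 H.in_arcsD2 by auto
      then show "(x, y) \<in> map_prod f f ` parcs G"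
        using xy arcs by force
    qed
  qed
  then have "with_proj H = app_iso ?h (with_proj G)"
    using img by (simp add: with_proj_def app_iso_def)
  ultimately show ?thesis
    unfolding digraph_iso_def by blast
qed

lemma pair_graph_complete_graph: "pair_graph (complete_graph n)"
proof -
  have "parcs (complete_graph n) \<subseteq> {1..n} \<times> {1..n}"
    by (auto simp: complete_graph_def)
  then have "finite (parcs (complete_graph n))"
    using finite_subset by blast
  then show ?thesis
    by unfold_locales (auto simp: complete_graph_def symmetric_def intro: symI)
qed

theorem proposition4p1:
  fixes G (structure)
    and A :: "'a pair_pre_digraph"
    and B :: "'a set set"
    and r :: nat
    and C :: "nat \<Rightarrow> 'a set"
    and n :: "nat \<Rightarrow> nat"
  assumes "group G" and "finite (carrier G)"
    and "pair_graph A" and "pverts A = carrier G"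
    and "partition_on (carrier G) B"
    and "bij_betw C {1..r} B"
    and "\<forall>i \<in> {1..r}. n i = card (C i)"
  shows "\<exists>\<Delta> :: nat pair_pre_digraph. pair_graph \<Delta> \<and> pverts \<Delta> = {1..r} \<and>
    digraph_iso (with_proj (super_graph B A))
      (with_proj (generalized_composition \<Delta> (\<lambda>i. complete_graph (n i))))"
proof -
  interpret A: pair_graph A by fact
  \<comment> \<open>The quotient of \<open>A\<close> by the blocks, carried over to indices along
    \<open>C\<close>. Arcs of \<open>A\<close> inside one block would become loops, hence
    \<open>i \<noteq> j\<close>; adjacency within a block is supplied by the complete graphs
    instead.\<close>
  define \<Delta> :: "nat pair_pre_digraph" where
    "\<Delta> = \<lparr> pverts = {1..r}, parcs = {(i, j). i \<in> {1..r} \<and> j \<in> {1..r} \<and> i \<noteq> j \<and>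
      (\<exists>g \<in> C i. \<exists>h \<in> C j. (g, h) \<in> parcs A)} \<rparr>"
  let ?K = "generalized_composition \<Delta> (\<lambda>i. complete_graph (n i))"
  have "parcs \<Delta> \<subseteq> {1..r} \<times> {1..r}"
    by (auto simp: \<Delta>_def)
  then have "finite (parcs \<Delta>)"
    using finite_subset by blast
  moreover have "sym (parcs \<Delta>)"
    unfolding \<Delta>_def by (rule symI) (simp, metis A.arcs_symmetric)
  ultimately have \<Delta>: "pair_graph \<Delta>"
    by unfold_locales (auto simp: \<Delta>_def symmetric_def)

  have C: "C i \<in> B" if "i \<in> {1..r}" for i
    using that assms(6) by (auto simp: bij_betw_def)
  have C_eq: "C i = C j \<longleftrightarrow> i = j" if "i \<in> {1..r}" "j \<in> {1..r}" for i j
    using that assms(6) by (auto simp: bij_betw_def dest: inj_onD)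
  have block: "block_of B g = C i" if "i \<in> {1..r}" "g \<in> C i" for i g
    using that assms(5) C block_of_eq by metis
  have union: "(\<Union>i \<in> {1..r}. C i) = carrier G"
    using assms(5,6) by (auto simp: partition_on_def bij_betw_def)

  have "\<exists>e. bij_betw e {1..n i} (C i)" if "i \<in> {1..r}" for i
  proof -
    have "C i \<subseteq> carrier G"
      using that union by blast
    then have "finite (C i)"
      using assms(2) finite_subset by blast
    then show ?thesis
      using that assms(7) ex_bij_betw_nat_finite_1 by metis
  qed
  then obtain e where e: "\<And>i. i \<in> {1..r} \<Longrightarrow> bij_betw (e i) {1..n i} (C i)"
    by metis
  have e_in: "e i u \<in> C i" if "i \<in> {1..r}" "u \<in> {1..n i}" for i u
    using e[OF that(1)] that(2) by (auto simp: bij_betw_def)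
  have e_eq: "e i u = e i v \<longleftrightarrow> u = v" if "i \<in> {1..r}" "u \<in> {1..n i}" "v \<in> {1..n i}" for i u v
    using e[OF that(1)] that(2,3) by (auto simp: bij_betw_def dest: inj_onD)
  \<comment> \<open>The map starts from the composition, where a vertex carries its block index
    explicitly; the isomorphism is reversed at the end.\<close>
  define f where "f = (\<lambda>(i, u). e i u)"
  have verts_K: "pverts ?K = (SIGMA i : {1..r}. {1..n i})"
    by (simp add: generalized_composition_def complete_graph_def \<Delta>_def)
  have "inj_on f (SIGMA i : {1..r}. {1..n i})"
  proof (rule inj_onI, clarify)
    fix i u j v
    assume *: "i \<in> {1..r}" "u \<in> {1..n i}" "j \<in> {1..r}" "v \<in> {1..n j}" "f (i, u) = f (j, v)"
    \<comment> \<open>The common image lies in both \<open>C i\<close> and \<open>C j\<close>, and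
      its block is unique.\<close>
    then have "C i = C j"
      using block e_in unfolding f_def by (metis case_prod_conv)
    then show "i = j \<and> u = v"
      using * C_eq e_eq by (auto simp: f_def)
  qed
  moreover have "f ` (SIGMA i : {1..r}. {1..n i}) = (\<Union>i \<in> {1..r}. e i ` {1..n i})"
    by (force simp: f_def)
  moreover have "\<dots> = (\<Union>i \<in> {1..r}. C i)"
    using e by (simp add: bij_betw_def)
  ultimately have "bij_betw f (pverts ?K) (pverts (super_graph B A))"
    using union assms(4) by (simp add: bij_betw_def verts_K super_graph_def)
  \<comment> \<open>For \<open>i = j\<close> both sides say \<open>u \<noteq> v\<close>. For
    \<open>i \<noteq> j\<close> the blocks differ, and the super graph condition on
    \<open>C i\<close> and \<open>C j\<close> is the one defining the arcs of
    \<open>\<Delta>\<close>.\<close>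
  moreover have "(f x, f y) \<in> parcs (super_graph B A) \<longleftrightarrow> (x, y) \<in> parcs ?K"
    if "x \<in> pverts ?K" "y \<in> pverts ?K" for x y
  proof -
    obtain i u j v where xy: "x = (i, u)" "y = (j, v)"
      by (cases x; cases y)
    with that have mem: "i \<in> {1..r}" "u \<in> {1..n i}" "j \<in> {1..r}" "v \<in> {1..n j}"
      by (simp_all add: verts_K)
    have "e i u \<in> carrier G" "e j v \<in> carrier G"
      using mem e_in union by blast+
    moreover have blocks: "block_of B (e i u) = C i" "block_of B (e j v) = C j"
      using mem block e_in by blast+
    \<comment> \<open>Adjacency in the super graph also demands distinct vertices, which
      \<open>\<Delta>\<close> does not mention.\<close>
    moreover have "e i u \<noteq> e j v" if "i \<noteq> j"
      using that mem C_eq blocks by metis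
    ultimately show ?thesis
      using mem e_eq C_eq xy assms(4)
      by (auto simp: f_def super_graph_def generalized_composition_def complete_graph_def \<Delta>_def)
  qed
  moreover have "pair_wf_digraph ?K" "pair_wf_digraph (super_graph B A)"
    using pair_graph_generalized_composition[OF \<Delta> pair_graph_complete_graph]
      pair_graph_super_graph[OF assms(3)]
    by (simp_all add: pair_graph_def pair_digraph_def pair_fin_digraph_def)
  ultimately have "digraph_iso (with_proj ?K) (with_proj (super_graph B A))"
    by (intro digraph_iso_with_projI)
  then have "digraph_iso (with_proj (super_graph B A)) (with_proj ?K)"
    using \<open>pair_wf_digraph ?K\<close> digraph_iso_swap wf_digraph_wp_iff by blast
  then show ?thesis
    using \<Delta> by (intro exI[of _ \<Delta>]) (simp add: \<Delta>_def)
qed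

end
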